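(* Let $D$ be a loose multipartite tournament. If $C_{1,2}(D)$ has a hole of length at least five, then there exists a partite set $X$ of $D$ such that: (1) $X$ is the only partite set of $D$ that is not $\{1,2\}$-competing; (2) for every hole $L$ of $C_{1,2}(D)$ of length at least five, there exists a partite set $Y\ne X$ with $|Y|\ge|V(L)|$ and $V(L)\subseteq\{v\in V(D):\emptyset\ne N^+(v)\subseteq Y\}\subseteq X$.
   Context: All graphs and digraphs are finite and simple. For a digraph $D$ and vertex $v$, $N^+(v)$ is its out-neighborhood; $d_D(x,y)$ is the length of a shortest directed path from $x$ to $y$. The $(1,2)$-step competition graph $C_{1,2}(D)$ is the graph on $V(D)$ in which distinct $u,v$ are adjacent iff there is a vertex $w\notin\{u,v\}$ with either $d_{D-v}(u,w)\le 1$ and $d_{D-u}(v,w)\le 2$, or $d_{D-u}(v,w)\le 1$ and $d_{D-v}(u,w)\le 2$. A multipartite tournament is an orientation of a complete $k$-partite graph for some $k\ge3$ (with nonempty partite sets). A set of vertices is $\{1,2\}$-competing if it is a clique in $C_{1,2}(D)$. A multipartite tournament is loose if some partite set is not $\{1,2\}$-competing. A hole of a graph is an induced cycle of length at least four. *)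

theory Defs
  imports
    "Graph_Theory.Graph_Theory"
    "HOL-Library.Disjoint_Sets"
    "HOL-Library.Extended_Nat"
begin

text \<open>Simple digraphs are pair digraphs; simple graphs are symmetric loopfree pair digraphs.\<close>

definition out_nbrs :: "'a pair_pre_digraph \<Rightarrow> 'a \<Rightarrow> 'a set" where
  "out_nbrs D v = {w. (v, w) \<in> parcs D}"

text \<open>The infimum of the empty set is \<open>\<infinity>\<close>, so the distance is infinite if there is no path
  (in particular if an endpoint is not a vertex).\<close>

definition ddist :: "('a, 'b) pre_digraph \<Rightarrow> 'a \<Rightarrow> 'a \<Rightarrow> enat" where
  "ddist G x y = (INF p \<in> {p. pre_digraph.apath G x p y}. enat (length p))"

definition comp12_graph :: "'a pair_pre_digraph \<Rightarrow> 'a pair_pre_digraph" where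
  "comp12_graph D = \<lparr> pverts = pverts D, parcs =
     {(u, v). u \<in> pverts D \<and> v \<in> pverts D \<and> u \<noteq> v \<and>
       (\<exists>w \<in> pverts D - {u, v}.
          ddist (pre_digraph.del_vert (with_proj D) v) u w \<le> 1 \<and>
          ddist (pre_digraph.del_vert (with_proj D) u) v w \<le> 2 \<or>
          ddist (pre_digraph.del_vert (with_proj D) u) v w \<le> 1 \<and>
          ddist (pre_digraph.del_vert (with_proj D) v) u w \<le> 2)} \<rparr>"

definition complete_multipartite :: "'a set set \<Rightarrow> 'a pair_pre_digraph" where
  "complete_multipartite P = \<lparr> pverts = \<Union>P, parcs =
     {(u, v). \<exists>X \<in> P. \<exists>Y \<in> P. X \<noteq> Y \<and> u \<in> X \<and> v \<in> Y} \<rparr>"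

definition orientation :: "'a pair_pre_digraph \<Rightarrow> 'a pair_pre_digraph \<Rightarrow> bool" where
  "orientation D G \<longleftrightarrow> pverts D = pverts G \<and>
     parcs D \<union> (parcs D)\<inverse> = parcs G \<and> parcs D \<inter> (parcs D)\<inverse> = {}"

text \<open>The family \<open>P\<close> of partite sets is determined by \<open>D\<close>
  (lemma \<open>multipartite_tournament_unique\<close> below); \<open>partition_on\<close> makes the parts nonempty.\<close>

definition multipartite_tournament :: "'a pair_pre_digraph \<Rightarrow> 'a set set \<Rightarrow> bool" where
  "multipartite_tournament D P \<longleftrightarrow>
     finite (pverts D) \<and> partition_on (pverts D) P \<and> 3 \<le> card P \<and>
     orientation D (complete_multipartite P)"

definition clique :: "'a pair_pre_digraph \<Rightarrow> 'a set \<Rightarrow> bool" where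
  "clique G S \<longleftrightarrow> S \<subseteq> pverts G \<and> (\<forall>u \<in> S. \<forall>v \<in> S. u \<noteq> v \<longrightarrow> (u, v) \<in> parcs G)"

definition competing12 :: "'a pair_pre_digraph \<Rightarrow> 'a set \<Rightarrow> bool" where
  "competing12 D S \<longleftrightarrow> clique (comp12_graph D) S"

definition loose :: "'a pair_pre_digraph \<Rightarrow> 'a set set \<Rightarrow> bool" where
  "loose D P \<longleftrightarrow> (\<exists>X \<in> P. \<not> competing12 D X)"

text \<open>A cycle as a graph: its vertices and edges are those of one closed directed cycle \<open>p\<close>
  and of its reversal. The bound on the length excludes the closed walk \<open>u, v, u\<close>, which is a
  cycle in the symmetric digraph but not in the graph.\<close>

definition cycle_graph :: "'a pair_pre_digraph \<Rightarrow> bool" where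
  "cycle_graph L \<longleftrightarrow> (\<exists>p. pre_digraph.cycle (with_proj L) p \<and> 3 \<le> length p \<and>
     pverts L = fst ` set p \<and> parcs L = set p \<union> (set p)\<inverse>)"

definition hole :: "'a pair_pre_digraph \<Rightarrow> 'a pair_pre_digraph \<Rightarrow> bool" where
  "hole G L \<longleftrightarrow> induced_subgraph (with_proj L) (with_proj G) \<and> cycle_graph L \<and>
     4 \<le> card (pverts L)"

lemma multipartite_tournament_pair_digraph:
  assumes "multipartite_tournament D P"
  shows "pair_digraph D"
proof -
  have fin: "finite (pverts D)" and part: "partition_on (pverts D) P"
    and V: "pverts D = \<Union>P"
    and E: "parcs D \<union> (parcs D)\<inverse> = {(u, v). \<exists>X \<in> P. \<exists>Y \<in> P. X \<noteq> Y \<and> u \<in> X \<and> v \<in> Y}"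
    using assms
    unfolding multipartite_tournament_def orientation_def complete_multipartite_def
      pair_pre_digraph.simps
    by - (elim conjE, assumption)+
  have arc: "\<exists>X \<in> P. \<exists>Y \<in> P. X \<noteq> Y \<and> u \<in> X \<and> v \<in> Y" if "(u, v) \<in> parcs D" for u v
  proof -
    have "(u, v) \<in> parcs D \<union> (parcs D)\<inverse>" using that by simp
    then show ?thesis unfolding E by simp
  qed
  have sub: "parcs D \<subseteq> pverts D \<times> pverts D"
  proof (rule subrelI)
    fix u v assume "(u, v) \<in> parcs D"
    from arc[OF this] show "(u, v) \<in> pverts D \<times> pverts D" unfolding V by auto
  qed
  have irr: "u \<noteq> v" if "(u, v) \<in> parcs D" for u v
    using arc[OF that] part by (meson disjointD disjoint_iff partition_onD2)
  have "finite (parcs D)"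
    by (rule finite_subset[OF sub]) (use fin in simp)
  show ?thesis
  proof
    fix e assume e: "e \<in> parcs D"
    obtain u v where uv: "e = (u, v)" by (cases e)
    show "fst e \<in> pverts D" "snd e \<in> pverts D" using e uv sub by auto
    show "fst e \<noteq> snd e" using e uv irr by simp
  qed fact+
qed

lemma multipartite_tournament_unique:
  assumes "multipartite_tournament D P" "multipartite_tournament D Q"
  shows "P = Q"
proof -
  have main: "P = (\<lambda>u. {v \<in> pverts D. (u, v) \<notin> parcs D \<union> (parcs D)\<inverse>}) ` pverts D"
    if "multipartite_tournament D P" for P
  proof -
    have part: "partition_on (pverts D) P" and V: "pverts D = \<Union>P"
      and E: "parcs D \<union> (parcs D)\<inverse> = {(u, v). \<exists>X \<in> P. \<exists>Y \<in> P. X \<noteq> Y \<and> u \<in> X \<and> v \<in> Y}"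
      using that
      unfolding multipartite_tournament_def orientation_def complete_multipartite_def
      pair_pre_digraph.simps
    by - (elim conjE, assumption)+
    have eq: "{v \<in> pverts D. (u, v) \<notin> parcs D \<union> (parcs D)\<inverse>} = X" if "X \<in> P" "u \<in> X" for u X
    proof -
      have "(u, v) \<in> parcs D \<union> (parcs D)\<inverse> \<longleftrightarrow> v \<notin> X" if v: "v \<in> pverts D" for v
      proof -
        obtain Y where Y: "Y \<in> P" "v \<in> Y" using v V by auto
        have uX: "Z = X" if "Z \<in> P" "u \<in> Z" for Z
          using that \<open>X \<in> P\<close> \<open>u \<in> X\<close> part by (meson disjointD disjoint_iff partition_onD2)
        have vY: "Z = Y" if "Z \<in> P" "v \<in> Z" for Z
          using that Y part by (meson disjointD disjoint_iff partition_onD2)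
        have "(\<exists>X \<in> P. \<exists>Y \<in> P. X \<noteq> Y \<and> u \<in> X \<and> v \<in> Y) \<longleftrightarrow> v \<notin> X"
          using uX vY Y \<open>X \<in> P\<close> \<open>u \<in> X\<close> by metis
        then show ?thesis unfolding E by simp
      qed
      moreover have "X \<subseteq> pverts D" using that V by auto
      ultimately show ?thesis by auto
    qed
    have ne: "X \<noteq> {}" if "X \<in> P" for X
      using that part by (auto simp: partition_on_def)
    show ?thesis
    proof (intro equalityI subsetI)
      fix X assume X: "X \<in> P"
      then obtain u where u: "u \<in> X" using ne by blast
      with X V have "u \<in> pverts D" by blast
      with eq[OF X u] show "X \<in> (\<lambda>u. {v \<in> pverts D. (u, v) \<notin> parcs D \<union> (parcs D)\<inverse>}) ` pverts D"
        by (metis (lifting) imageI)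
    next
      fix X assume "X \<in> (\<lambda>u. {v \<in> pverts D. (u, v) \<notin> parcs D \<union> (parcs D)\<inverse>}) ` pverts D"
      then obtain u where "u \<in> pverts D"
        and X: "X = {v \<in> pverts D. (u, v) \<notin> parcs D \<union> (parcs D)\<inverse>}" by blast
      then obtain Y where "Y \<in> P" "u \<in> Y" using V by blast
      then show "X \<in> P" using eq X by simp
    qed
  qed
  show ?thesis using main[OF assms(1)] main[OF assms(2)] by simp
qed

end

theory Submission
  imports Defs
begin

text \<open>
  Since any two vertices of different partite sets are joined by an arc, distinct \<open>u\<close>, \<open>v\<close> are
  non-adjacent in \<open>C\<^sub>1\<^sub>,\<^sub>2(D)\<close> iff \<open>N\<^sup>+(u) \<subseteq> {v}\<close>, or \<open>N\<^sup>+(v) \<subseteq> {u}\<close>, or \<open>N\<^sup>+(u) - {v}\<close> and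
  \<open>N\<^sup>+(v) - {u}\<close> are disjoint subsets of a single partite set.

  Let \<open>H = c\<^sub>0, c\<^sub>1, \<dots>\<close> be a hole of length \<open>n \<ge> 5\<close>. First, no vertex of \<open>H\<close> has a vertex of \<open>H\<close>
  as its only out-neighbour: if \<open>N\<^sup>+(c\<^sub>i) = {v}\<close> and \<open>c\<^sub>i\<^sub>+\<^sub>1\<close> is not adjacent to \<open>v\<close>, then
  \<open>N\<^sup>+(c\<^sub>i\<^sub>+\<^sub>2) = {c\<^sub>i}\<close>, and iterating this around the hole is contradictory. Hence the first two
  kinds of non-adjacency do not occur inside \<open>H\<close>. It follows that each \<open>N\<^sup>+(c\<^sub>i)\<close> lies in one partite
  set, and, the complement of \<open>H\<close> being connected, in the same \<open>Y\<close> for all \<open>i\<close>. Then \<open>H\<close> misses \<open>Y\<close>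
  and contains no arc, so it lies in a single partite set \<open>X\<close>.

  Adjacent vertices of \<open>H\<close> now share an out-neighbour in \<open>Y\<close>, and the in-neighbours within \<open>H\<close>
  of any vertex form a clique, so the \<open>n\<close> edges of \<open>H\<close> yield \<open>n\<close> elements of \<open>Y\<close>. Two vertices outside \<open>X\<close>
  in the same partite set each have at most two in-neighbours in \<open>H\<close>, so they share an
  out-neighbour there; thus \<open>X\<close> is the only partite set that is not competing.
\<close>

section \<open>Competition in oriented complete multipartite graphs\<close>

locale oriented_multipartite =
  fixes V :: "'a set" and A :: "'a \<Rightarrow> 'a \<Rightarrow> bool" and f :: "'a \<Rightarrow> 'b"
  assumes arc_verts: "A x y \<Longrightarrow> x \<in> V \<and> y \<in> V"
    and arc_asym: "A x y \<Longrightarrow> \<not> A y x"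
    and arc_parts: "A x y \<Longrightarrow> f x \<noteq> f y"
    and arc_total: "\<lbrakk>x \<in> V; y \<in> V; f x \<noteq> f y\<rbrakk> \<Longrightarrow> A x y \<or> A y x"
begin

text \<open>Adjacency in \<open>C\<^sub>1\<^sub>,\<^sub>2(D)\<close> freed of distances: if
  \<open>a\<close> and \<open>b\<close> lie in different parts, they are joined by an arc, and its
  head is the common target.\<close>

definition compete :: "'a \<Rightarrow> 'a \<Rightarrow> bool" where
  "compete u v \<longleftrightarrow> u \<noteq> v \<and> (\<exists>a b. A u a \<and> a \<noteq> v \<and> A v b \<and> b \<noteq> u \<and> (a = b \<or> f a \<noteq> f b))"

lemma compete_sym: "compete u v \<Longrightarrow> compete v u"
  unfolding compete_def by metis

lemma compete_common: "\<lbrakk>A u a; A v a; u \<noteq> v\<rbrakk> \<Longrightarrow> compete u v"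
  unfolding compete_def using arc_parts by metis

lemma nonadj_parts: "\<lbrakk>\<not> compete u v; u \<noteq> v; A u a; a \<noteq> v; A v b; b \<noteq> u\<rbrakk> \<Longrightarrow> f a = f b"
  unfolding compete_def by metis

text \<open>The hole is wrapped around the integers with period \<open>n\<close>, so that shifts and
  reflections act on indices and adjacency becomes divisibility.\<close>

definition hole_cycle :: "int \<Rightarrow> (int \<Rightarrow> 'a) \<Rightarrow> bool" where
  "hole_cycle n c \<longleftrightarrow> 5 \<le> n \<and> (\<forall>i. c i \<in> V) \<and> (\<forall>i j. c i = c j \<longleftrightarrow> n dvd i - j) \<and>
    (\<forall>i j. compete (c i) (c j) \<longleftrightarrow> n dvd i - j - 1 \<or> n dvd i - j + 1)"

text \<open>Reversal exchanges \<open>c (i-1)\<close> and \<open>c (i+1)\<close>, which settles the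
  mirror case in \<open>no_single_out\<close>.\<close>

lemma hole_cycle_reflect: assumes "hole_cycle n c" shows "hole_cycle n (\<lambda>i. c (- i))"
proof -
  have "n dvd - i - - j \<longleftrightarrow> n dvd i - j"
    "(n dvd - i - - j - 1 \<or> n dvd - i - - j + 1) \<longleftrightarrow> (n dvd i - j - 1 \<or> n dvd i - j + 1)" for i j
    using dvd_minus_iff[of n "i - j"] dvd_minus_iff[of n "i - j + 1"] dvd_minus_iff[of n "i - j - 1"]
    by (auto simp: algebra_simps)
  then show ?thesis using assms unfolding hole_cycle_def by simp
qed

lemma not_dvd_small: "\<lbrakk>(d::int) \<noteq> 0; \<bar>d\<bar> < n\<rbrakk> \<Longrightarrow> \<not> n dvd d"
  using zdvd_imp_le[of n "\<bar>d\<bar>"] by auto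

section \<open>No hole vertex has a hole vertex as its only out-neighbour\<close>

context
  fixes n c
  assumes cyc: "hole_cycle n c"
begin

lemma n_ge_5: "5 \<le> n" and cV: "c i \<in> V"
  and c_eq: "c i = c j \<longleftrightarrow> n dvd i - j"
  and c_compete: "compete (c i) (c j) \<longleftrightarrow> n dvd i - j - 1 \<or> n dvd i - j + 1"
  using cyc unfolding hole_cycle_def by auto

lemma c_ne: "i \<noteq> j \<Longrightarrow> \<bar>i - j\<bar> < 5 \<Longrightarrow> c i \<noteq> c j"
  using n_ge_5 by (simp add: c_eq not_dvd_small)

lemma c_adj: "\<bar>i - j\<bar> = 1 \<Longrightarrow> compete (c i) (c j)"
proof -
  assume "\<bar>i - j\<bar> = 1"
  then have "i - j - 1 = 0 \<or> i - j + 1 = 0" by linarith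
  then show ?thesis unfolding c_compete by auto
qed

lemma c_nonadj: "\<bar>i - j\<bar> = 2 \<or> \<bar>i - j\<bar> = 3 \<Longrightarrow> \<not> compete (c i) (c j)"
  using n_ge_5 not_dvd_small[of "i - j - 1" n] not_dvd_small[of "i - j + 1" n] unfolding c_compete by linarith

lemma c_nonadj4: "6 \<le> n \<Longrightarrow> \<bar>i - j\<bar> = 4 \<Longrightarrow> \<not> compete (c i) (c j)"
  using not_dvd_small[of "i - j - 1" n] not_dvd_small[of "i - j + 1" n] unfolding c_compete by linarith

lemma c_out: "\<exists>a. A (c i) a"
  using c_adj[of i "i+1"] unfolding compete_def by auto

text \<open>A further out-neighbour of \<open>w\<close> would determine the parts of
  \<open>q\<close>, \<open>u\<close> and \<open>p\<close> in turn, until the non-adjacency of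
  \<open>p\<close> and \<open>q\<close> puts \<open>u\<close> and its out-neighbour \<open>v\<close>
  into one part.\<close>

lemma single_out_step:
  assumes out: "\<And>x. A (c i) x \<longleftrightarrow> x = v" and nv: "\<not> compete (c (i+1)) v" and vH: "v = c j"
  shows "A (c (i+2)) x \<longleftrightarrow> x = c i"
proof -
  define p u q w where "p = c (i-1)" and "u = c i" and "q = c (i+1)" and "w = c (i+2)"
  note defs = p_def u_def q_def w_def
  have V: "p \<in> V" "u \<in> V" "q \<in> V" "w \<in> V" "v \<in> V" unfolding defs vH by (simp_all add: cV)
  have ne: "p \<noteq> u" "p \<noteq> q" "p \<noteq> w" "u \<noteq> q" "u \<noteq> w" "q \<noteq> w" unfolding defs by (simp_all add: c_ne)
  have adj: "compete p u" "compete u q" "compete q w" unfolding defs by (simp_all add: c_adj)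
  have non: "\<not> compete p q" "\<not> compete p w" "\<not> compete u w" unfolding defs by (simp_all add: c_nonadj)
  have Au: "A u x \<longleftrightarrow> x = v" for x using out unfolding u_def .
  have uv: "A u v" using Au by simp
  have nuv: "\<not> compete u v" unfolding compete_def using Au by metis
  have qv: "\<not> compete q v" using nv unfolding q_def .
  have vne: "v \<noteq> u" "v \<noteq> p" "v \<noteq> q" "v \<noteq> w"
    using uv arc_parts nuv adj non qv compete_sym by metis+
  have "A w u \<and> (\<forall>x. A w x \<longrightarrow> x = u)"
  proof (rule ccontr)
    assume "\<not> ?thesis"
    moreover obtain a where "A w a" using c_out unfolding w_def by blast
    ultimately obtain b where b: "A w b" "b \<noteq> u" by metis
    \<comment> \<open>\<open>u\<close> and \<open>w\<close> do not compete and \<open>u\<close> has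
      the out-neighbour \<open>v\<close>; \<open>v\<close> itself is excluded as a common
      out-neighbour.\<close>
    have wY: "f x = f v \<and> x \<noteq> v" if "A w x" "x \<noteq> u" for x
      using nonadj_parts[OF non(3) ne(5) uv vne(4) that] compete_common[OF uv, of w] that non(3) ne(5) by metis
    have wv: "f w \<noteq> f v" using wY[OF b] arc_parts[OF b(1)] by simp
    have vw: "A v w" using arc_total[OF V(4,5) wv] wY vne(1) by blast
    have qw: "\<not> A q w" using compete_common[OF _ vw] qv vne by metis
    \<comment> \<open>Otherwise \<open>u\<close> and \<open>q\<close> both have \<open>v\<close> as
      only out-neighbour, so they share a part. Competition of \<open>q\<close> and \<open>w\<close>
      forces an arc from \<open>w\<close> to \<open>u\<close>, hence one to \<open>q\<close>, and
      \<open>wY\<close> puts \<open>q\<close> into the part of \<open>v\<close>.\<close>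
    have "\<exists>x. A q x \<and> x \<noteq> v"
    proof (rule ccontr)
      assume "\<not> ?thesis"
      then have Aq: "A q x \<longleftrightarrow> x = v" for x using c_out[of "i+1"] unfolding q_def by metis
      obtain d where d: "A w d" "d \<noteq> q" "d = v \<or> f d \<noteq> f v"
        using adj(3) unfolding compete_def Aq by metis
      then have wu: "A w u" using wY by metis
      have "f q = f u" using arc_total[OF V(3,2)] Aq Au vne by metis
      then have "f w \<noteq> f q" using arc_parts[OF wu] by simp
      then have "A w q" using arc_total[OF V(4,3)] Aq vne by metis
      then show False using wY[of q] ne Aq arc_parts by metis
    qed
    then obtain x where x: "A q x" "x \<noteq> v" by blast
    have qpart: "f y = f w" if "A q y" "y \<noteq> v" for y
      using nonadj_parts[OF qv vne(3)[symmetric] that vw ne(6)[symmetric]] .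
    have "f q \<noteq> f w" using qpart[OF x] arc_parts[OF x(1)] by simp
    then have wq: "A w q" using arc_total[OF V(3,4)] qw by metis
    then have fq: "f q = f v" using wY ne by metis
    then have qu: "A q u" using arc_total[OF V(3,2)] Au arc_parts[OF uv] vne by metis
    then have fu: "f u = f w" using qpart vne by metis
    have "\<not> A p u" using compete_common[OF _ qu] non ne by metis
    then have fp: "f p = f u" using arc_total[OF V(1,2)] Au vne by metis
    \<comment> \<open>The out-neighbour \<open>q\<close> of \<open>w\<close> lies in the part of
      \<open>v\<close>, and \<open>p\<close> does not compete with \<open>w\<close>.\<close>
    have pY: "f y = f v" if "A p y" for y
    proof -
      have "y \<noteq> w" using arc_parts[OF that] fp fu by metis
      then show ?thesis using nonadj_parts[OF non(2) ne(3) that _ wq] ne fq by metis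
    qed
    have pv: "A p v" using adj(1) unfolding compete_def Au using pY by metis
    have "f u = f v" using nonadj_parts[OF non(1) ne(2) pv vne(3) qu ne(1)[symmetric]] by simp
    then show False using arc_parts[OF uv] by simp
  qed
  then show ?thesis unfolding defs by blast
qed

text \<open>The pattern reproduces itself in steps of two, since \<open>c (k+3)\<close> and
  \<open>c k\<close> are never adjacent.\<close>

lemma no_single_out_aux:
  assumes out: "\<And>x. A (c i) x \<longleftrightarrow> x = c j" and nv: "\<not> compete (c (i+1)) (c j)"
  shows False
proof -
  have s2: "A (c (i+2)) x \<longleftrightarrow> x = c i" for x using single_out_step[OF out nv refl] .
  have st: "A (c (k+4)) x \<longleftrightarrow> x = c (k+2)" if "\<And>x. A (c (k+2)) x \<longleftrightarrow> x = c k" for k x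
    using single_out_step[of "k+2" "c k" k x] that c_nonadj[of "k+3" k] by (simp add: add.commute)
  have s4: "A (c (i+4)) x \<longleftrightarrow> x = c (i+2)" for x using st[OF s2] .
  have s6: "A (c (i+6)) x \<longleftrightarrow> x = c (i+4)" for x using st[of "i+2"] s4 by (simp add: add.commute)
  have s8: "A (c (i+8)) x \<longleftrightarrow> x = c (i+6)" for x using st[of "i+4"] s6 by (simp add: add.commute)
  show False
  proof (cases "n = 5")
    case True
    \<comment> \<open>For \<open>n = 5\<close> the even steps wrap around to \<open>c (i+1)\<close>
      and \<open>c (i+3)\<close>. Neither is joined to \<open>c (i+2)\<close>, so all three share a
      part, although \<open>c (i+3)\<close> has an arc to \<open>c (i+1)\<close>.\<close>
    have e: "c (i+6) = c (i+1)" "c (i+8) = c (i+3)" unfolding c_eq True by simp_all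
    have A1: "A (c (i+1)) x \<longleftrightarrow> x = c (i+4)" and A3: "A (c (i+3)) x \<longleftrightarrow> x = c (i+1)" for x
      using s6 s8 unfolding e by auto
    have "f (c (i+1)) = f (c (i+2))"
      using arc_total[of "c (i+1)" "c (i+2)"] A1 s2 cV c_ne[of "i+2" "i+4"] c_ne[of "i+1" i] by auto
    moreover have "f (c (i+3)) = f (c (i+2))"
      using arc_total[of "c (i+3)" "c (i+2)"] A3 s2 cV c_ne[of "i+2" "i+1"] c_ne[of "i+3" i] by auto
    moreover have "f (c (i+3)) \<noteq> f (c (i+1))" using A3 arc_parts by metis
    ultimately show False by simp
  next
    case False
    then have n6: "6 \<le> n" using n_ge_5 by simp
    have "f (c (i+4)) \<noteq> f (c (i+2))" using s4 arc_parts by metis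
    \<comment> \<open>By pigeonhole, two of the pairwise non-adjacent \<open>c (i+1)\<close>,
      \<open>c (i+3)\<close>, \<open>c (i+5)\<close> will then share an out-neighbour.\<close>
    then have beat: "A x (c (i+2)) \<or> A x (c (i+4))" if "x \<in> V" "x \<noteq> c i" "x \<noteq> c (i+2)" for x
      using arc_total[of x "c (i+2)"] arc_total[of x "c (i+4)"] that s2 s4 cV by metis
    have "c (i+5) \<noteq> c i" unfolding c_eq using n6 by (simp add: not_dvd_small)
    then have b: "A (c (i+1)) (c (i+2)) \<or> A (c (i+1)) (c (i+4))" "A (c (i+3)) (c (i+2)) \<or> A (c (i+3)) (c (i+4))"
      "A (c (i+5)) (c (i+2)) \<or> A (c (i+5)) (c (i+4))"
      by (simp_all add: beat cV c_ne)
    have "\<not> compete (c (i+1)) (c (i+3))" "\<not> compete (c (i+3)) (c (i+5))" "\<not> compete (c (i+1)) (c (i+5))"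
      "c (i+1) \<noteq> c (i+3)" "c (i+3) \<noteq> c (i+5)" "c (i+1) \<noteq> c (i+5)"
      using n6 by (simp_all add: c_nonadj c_nonadj4 c_ne)
    then show False using b compete_common by metis
  qed
qed

end

lemma no_single_out:
  assumes cyc: "hole_cycle n c" shows "\<not> (\<forall>x. A (c i) x \<longleftrightarrow> x = c j)"
proof
  assume out: "\<forall>x. A (c i) x \<longleftrightarrow> x = c j"
  have nE: "\<not> compete (c i) (c j)" unfolding compete_def using out by metis
  have nij: "c i \<noteq> c j" using out arc_parts by metis
  \<comment> \<open>If both neighbours of \<open>c i\<close> competed with \<open>c j\<close>, then
    \<open>j\<close> would be both \<open>i + 2\<close> and \<open>i - 2\<close> modulo
    \<open>n\<close>, so \<open>n\<close> would divide 4.\<close>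
  consider "\<not> compete (c (i+1)) (c j)" | "\<not> compete (c (i-1)) (c j)"
  proof (rule ccontr)
    assume "\<not> thesis"
    then have "compete (c (i+1)) (c j)" "compete (c (i-1)) (c j)" using that by auto
    then have "(n dvd i - j \<or> n dvd i - j + 2) \<and> (n dvd i - j \<or> n dvd i - j - 2)"
      unfolding c_compete[OF cyc] by (auto simp: algebra_simps)
    then have "n dvd i - j + 2" "n dvd i - j - 2" using nij unfolding c_eq[OF cyc] by auto
    then have "n dvd 4" using dvd_diff[of n "i-j+2" "i-j-2"] by simp
    then show False using n_ge_5[OF cyc] not_dvd_small[of 4 n] by simp
  qed
  then show False
  proof cases
    case 1
    then show False using no_single_out_aux[OF cyc] out by blast
  next
    case 2
    then show False using no_single_out_aux[OF hole_cycle_reflect[OF cyc], of "-i" "-j"] out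
      by (simp add: algebra_simps)
  qed
qed

section \<open>Out-neighbourhoods along the hole\<close>

context
  fixes n c
  assumes cyc: "hole_cycle n c"
begin

lemma out_other: "\<exists>a. A (c i) a \<and> a \<noteq> c j"
  using no_single_out[OF cyc, of i j] c_out[OF cyc, of i] by metis

text \<open>Comparison with the non-neighbours \<open>v\<close> and \<open>w\<close> shows that two
  parts could only come from \<open>v\<close> and \<open>w\<close> themselves. These are then joined
  by an arc, whose head is a common out-neighbour of its tail and \<open>c i\<close>, which do not
  compete.\<close>

lemma out_one_part:
  assumes "A (c i) a" "A (c i) b" shows "f a = f b"
proof (rule ccontr)
  assume ab: "f a \<noteq> f b"
  define v w where "v = c (i+2)" and "w = c (i+3)"
  have V: "v \<in> V" "w \<in> V" unfolding v_def w_def by (simp_all add: cV[OF cyc])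
  have non: "\<not> compete (c i) v" "c i \<noteq> v" "\<not> compete (c i) w" "c i \<noteq> w" "v \<noteq> w"
    unfolding v_def w_def by (simp_all add: c_nonadj[OF cyc] c_ne[OF cyc])
  obtain a' where a': "A v a'" "a' \<noteq> c i"
    using out_other[of "i+2" i] unfolding v_def by blast
  obtain b' where b': "A w b'" "b' \<noteq> c i"
    using out_other[of "i+3" i] unfolding w_def by blast
  have p1: "f x = f a'" if "A (c i) x" "x \<noteq> v" for x
    using nonadj_parts[OF non(1,2) that a'] .
  have p2: "f x = f b'" if "A (c i) x" "x \<noteq> w" for x
    using nonadj_parts[OF non(3,4) that b'] .
  have "a = v \<or> b = v" "a = w \<or> b = w" using p1 p2 assms ab by metis+
  then have vw: "A (c i) v" "A (c i) w" "f v \<noteq> f w" using non(5) assms ab by auto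
  have "f x = f w" if "A v x" for x
    using nonadj_parts[OF non(1,2) vw(2) non(5)[symmetric] that] arc_asym[OF vw(1)] that by metis
  moreover have "f x = f v" if "A w x" for x
    using nonadj_parts[OF non(3,4) vw(1) non(5) that] arc_asym[OF vw(2)] that by metis
  moreover have "x \<noteq> w" if "A v x" for x
    using compete_common[OF vw(2), of v] that non by metis
  moreover have "x \<noteq> v" if "A w x" for x
    using compete_common[OF vw(1), of w] that non by metis
  ultimately show False using arc_total[OF V vw(3)] by metis
qed

lemma nonadj_out_part:
  assumes "\<not> compete (c i) (c j)" "c i \<noteq> c j" "A (c i) a" "A (c j) b"
  shows "f a = f b"
proof -
  obtain a' where a': "A (c i) a'" "a' \<noteq> c j" using out_other by blast
  obtain b' where b': "A (c j) b'" "b' \<noteq> c i" using out_other by blast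
  show ?thesis using nonadj_parts[OF assms(1,2) a' b'] out_one_part assms a' b' by metis
qed

lemma out_part:
  obtains y where "\<And>i x. A (c i) x \<Longrightarrow> f x = y"
proof -
  obtain a where a: "A (c 0) a" using c_out[OF cyc] by blast
  \<comment> \<open>\<open>c (i+3)\<close> is non-adjacent to both \<open>c i\<close> and
    \<open>c (i+1)\<close>, even for \<open>n = 5\<close>, and so links their parts.\<close>
  have nx: "f x = f z" if "A (c i) x" "A (c (i+1)) z" for i x z
  proof -
    obtain t where t: "A (c (i+3)) t" using c_out[OF cyc] by blast
    have "f x = f t" using nonadj_out_part[OF _ _ that(1) t] c_nonadj[OF cyc] c_ne[OF cyc] by simp
    moreover have "f z = f t" using nonadj_out_part[OF _ _ that(2) t] c_nonadj[OF cyc] c_ne[OF cyc] by simp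
    ultimately show ?thesis by simp
  qed
  have "\<forall>x. A (c i) x \<longrightarrow> f x = f a" for i
  proof (induction i rule: int_induct[where k=0])
    case base
    show ?case using a out_one_part by blast
  next
    case (step1 i)
    then show ?case using nx[of i] c_out[OF cyc, of i] by metis
  next
    case (step2 i)
    then show ?case using nx[of "i-1"] c_out[OF cyc, of i] by (metis diff_add_cancel)
  qed
  then show ?thesis using that by blast
qed

text \<open>Every hole vertex has all its out-neighbours in part \<open>y\<close>, so none lies in
  \<open>y\<close>, and no arc joins two of them.\<close>

lemma same_part:
  "f (c i) = f (c j)"
proof (rule ccontr)
  assume d: "f (c i) \<noteq> f (c j)"
  obtain y where y: "\<And>i x. A (c i) x \<Longrightarrow> f x = y" using out_part by metis
  have "f (c k) \<noteq> y" for k using y c_out[OF cyc, of k] arc_parts by metis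
  then show False using arc_total[OF cV[OF cyc] cV[OF cyc] d] y by metis
qed

lemma common_out:
  assumes "compete (c i) (c j)" shows "\<exists>y. A (c i) y \<and> A (c j) y"
  using assms out_part unfolding compete_def by metis

text \<open>A vertex chosen for two edges of the hole would have in-neighbours two steps apart on
  the hole, which do not compete. So the edges inject into \<open>Y\<close>.\<close>

lemma out_card:
  assumes out: "\<And>i x. A (c i) x \<Longrightarrow> x \<in> Y" and fin: "finite Y"
  shows "n \<le> int (card Y)"
proof -
  have "\<forall>i. \<exists>y. A (c i) y \<and> A (c (i+1)) y" using common_out c_adj[OF cyc] by simp
  then obtain y where y: "\<And>i. A (c i) (y i)" "\<And>i. A (c (i+1)) (y i)" by metis
  have far: False if "A (c k) z" "A (c (k+2)) z" for k z
    using compete_common[OF that] c_nonadj[OF cyc, of k "k+2"] c_ne[OF cyc, of k "k+2"] by simp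
  have inj: "c i = c j" if e: "y i = y j" for i j
  proof (rule ccontr)
    assume ne: "c i \<noteq> c j"
    have "compete (c i) (c j)" using compete_common[OF y(1)[of i] _ ne] y(1)[of j] e by simp
    then consider "n dvd i - (j + 1)" | "n dvd j - (i + 1)"
      unfolding c_compete[OF cyc] using dvd_minus_iff[of n "i - j + 1"] by (auto simp: algebra_simps)
    then show False
    proof cases
      case 1
      then have "n dvd (i + 1) - (j + 2)" by (simp add: algebra_simps)
      then have "c (i+1) = c (j+2)" unfolding c_eq[OF cyc] .
      then show False using far[of j "y j"] y e by metis
    next
      case 2
      then have "n dvd (j + 1) - (i + 2)" by (simp add: algebra_simps)
      then have "c (j+1) = c (i+2)" unfolding c_eq[OF cyc] .
      then show False using far[of i "y i"] y e by metis
    qed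
  qed
  have "inj_on y {0..<n}"
  proof (rule inj_onI)
    fix i j assume "i \<in> {0..<n}" "j \<in> {0..<n}" "y i = y j"
    then show "i = j" using inj[of i j] not_dvd_small[of "i - j" n] unfolding c_eq[OF cyc] by force
  qed
  then have "card {0..<n} \<le> card Y" using card_inj_on_le[of y "{0..<n}" Y] out y(1) fin by blast
  then show ?thesis by simp
qed

text \<open>As in \<open>same_part\<close>: an arc between \<open>v\<close> and \<open>c i\<close>
  would have its head in part \<open>y\<close>, where neither lies.\<close>

lemma out_in_part:
  assumes out: "\<And>i x. A (c i) x \<Longrightarrow> f x = y" and v: "A v a" "\<And>x. A v x \<Longrightarrow> f x = y"
  shows "f v = f (c i)"
proof (rule ccontr)
  assume d: "f v \<noteq> f (c i)"
  have "f v \<noteq> y" using v arc_parts by metis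
  moreover have "f (c i) \<noteq> y" using out c_out[OF cyc] arc_parts by metis
  ultimately show False using arc_total[OF _ cV[OF cyc] d] arc_verts v out by metis
qed

text \<open>Without a common out-neighbour of \<open>z1\<close> and \<open>z2\<close>, each hole
  vertex has an arc to one of them.\<close>

lemma other_part_adj:
  assumes z: "z1 \<in> V" "z2 \<in> V" "z1 \<noteq> z2" "f z1 = f z2" "f z1 \<noteq> f (c 0)"
  shows "compete z1 z2"
proof (rule ccontr)
  assume nE: "\<not> compete z1 z2"
  have arc: "A (c i) z1 \<or> A (c i) z2" for i
    using arc_total[OF cV[OF cyc], of z1 i] arc_total[OF cV[OF cyc], of z2 i] same_part[of i 0] z
      compete_common nE by metis
  have far: "\<not> (A (c i) z \<and> A (c j) z)" if "\<bar>i - j\<bar> = 2 \<or> \<bar>i - j\<bar> = 3" for i j z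
    using compete_common[of "c i" z "c j"] c_nonadj[OF cyc that] c_ne[OF cyc, of i j] that by auto
  \<comment> \<open>In the order 0, 2, 4, 1, 3 successive vertices are non-adjacent and close up to
    an odd cycle, which the two colours \<open>z1\<close> and \<open>z2\<close> cannot colour
    properly.\<close>
  have k: "\<not> (A (c 0) z \<and> A (c 2) z)" "\<not> (A (c 2) z \<and> A (c 4) z)" "\<not> (A (c 4) z \<and> A (c 1) z)"
    "\<not> (A (c 1) z \<and> A (c 3) z)" "\<not> (A (c 3) z \<and> A (c 0) z)" for z
    by (rule far, simp)+
  show False
    using k[of z1] k[of z2] arc[of 0] arc[of 1] arc[of 2] arc[of 3] arc[of 4] by blast
qed

end

end

section \<open>Distances after deleting a vertex, and arcs of the competition graph\<close>

lemma ddist_le_iff: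
  "ddist G x y \<le> enat k \<longleftrightarrow> (\<exists>p. pre_digraph.apath G x p y \<and> length p \<le> k)"
proof -
  \<comment> \<open>A strict bound on an infimum yields an element below it; this also covers the
    infinite distance when no path exists.\<close>
  have "ddist G x y \<le> enat k \<longleftrightarrow> ddist G x y < enat (Suc k)"
    by (meson Suc_ile_eq not_less)
  then show ?thesis unfolding ddist_def INF_less_iff by (auto simp: less_Suc_eq_le)
qed

lemma apath_del_vert_iff:
  "pre_digraph.apath (pre_digraph.del_vert (with_proj D) v) u p w \<longleftrightarrow>
    u \<in> pverts D \<and> u \<noteq> v \<and> set p \<subseteq> {e \<in> parcs D. fst e \<noteq> v \<and> snd e \<noteq> v} \<and>
    pre_digraph.cas (with_proj D) u p w \<and> distinct (pre_digraph.awalk_verts (with_proj D) u p)"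
proof -
  \<comment> \<open>Deletion keeps the tail and head maps, on which alone \<open>cas\<close> and
    \<open>awalk_verts\<close> depend.\<close>
  have "pre_digraph.cas (pre_digraph.del_vert (with_proj D) v) u p w = pre_digraph.cas (with_proj D) u p w"
    by (induction p arbitrary: u) (simp_all add: pre_digraph.cas.simps pre_digraph.del_vert_simps)
  moreover have "pre_digraph.awalk_verts (pre_digraph.del_vert (with_proj D) v) u p =
      pre_digraph.awalk_verts (with_proj D) u p"
    by (induction p arbitrary: u) (simp_all add: pre_digraph.awalk_verts.simps pre_digraph.del_vert_simps)
  ultimately show ?thesis
    unfolding pre_digraph.apath_def pre_digraph.awalk_def
    by (auto simp: pre_digraph.del_vert_simps)
qed

context pair_digraph begin

lemma ddist_del_vert_le_1:
  assumes "u \<noteq> w" "u \<noteq> v" "w \<noteq> v"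
  shows "ddist (pre_digraph.del_vert (with_proj G) v) u w \<le> 1 \<longleftrightarrow> (u, w) \<in> parcs G"
proof
  assume "ddist (pre_digraph.del_vert (with_proj G) v) u w \<le> 1"
  then obtain p where "pre_digraph.apath (pre_digraph.del_vert (with_proj G) v) u p w" "length p \<le> 1"
    unfolding one_enat_def ddist_le_iff by blast
  then show "(u, w) \<in> parcs G" using assms(1)
    unfolding apath_del_vert_iff by (cases p) (auto simp: pre_digraph.cas.simps)
next
  assume a: "(u, w) \<in> parcs G"
  then have "pre_digraph.apath (pre_digraph.del_vert (with_proj G) v) u [(u, w)] w"
    using assms in_arcsD1 unfolding apath_del_vert_iff
    by (auto simp: pre_digraph.cas.simps pre_digraph.awalk_verts.simps)
  then show "ddist (pre_digraph.del_vert (with_proj G) v) u w \<le> 1"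
    unfolding one_enat_def ddist_le_iff by force
qed

lemma ddist_del_vert_le_2:
  assumes "u \<noteq> w" "u \<noteq> v" "w \<noteq> v"
  shows "ddist (pre_digraph.del_vert (with_proj G) v) u w \<le> 2 \<longleftrightarrow>
    (u, w) \<in> parcs G \<or> (\<exists>z. z \<noteq> v \<and> (u, z) \<in> parcs G \<and> (z, w) \<in> parcs G)" (is "?l \<longleftrightarrow> ?r")
proof
  have e2: "(2::enat) = enat 2" by (rule numeral_eq_enat)
  assume ?l
  then obtain p where p: "pre_digraph.apath (pre_digraph.del_vert (with_proj G) v) u p w" "length p \<le> 2"
    unfolding e2 ddist_le_iff by blast
  then consider "p = []" | e where "p = [e]" | e e' where "p = [e, e']"
    by (cases p; cases "tl p") auto
  then show ?r using p(1) assms(1) unfolding apath_del_vert_iff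
    by cases (auto simp: pre_digraph.cas.simps)
next
  have e2: "(2::enat) = enat 2" by (rule numeral_eq_enat)
  assume ?r
  then consider "(u, w) \<in> parcs G" | z where "z \<noteq> v" "(u, z) \<in> parcs G" "(z, w) \<in> parcs G" by blast
  then show ?l
  proof cases
    case 1
    then have "ddist (pre_digraph.del_vert (with_proj G) v) u w \<le> 1" using ddist_del_vert_le_1[OF assms] by simp
    also have "(1::enat) \<le> 2" by (simp add: one_enat_def e2)
    finally show ?thesis .
  next
    case 2
    have "u \<noteq> z" "z \<noteq> w" using no_loops'[OF 2(2)] no_loops'[OF 2(3)] by auto
    then have "pre_digraph.apath (pre_digraph.del_vert (with_proj G) v) u [(u, z), (z, w)] w"
      using assms 2 in_arcsD1 unfolding apath_del_vert_iff
      by (auto simp: pre_digraph.cas.simps pre_digraph.awalk_verts.simps)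
    then show ?thesis unfolding e2 ddist_le_iff by force
  qed
qed

lemma comp12_arc_iff:
  "(u, v) \<in> parcs (comp12_graph G) \<longleftrightarrow> u \<noteq> v \<and>
    (\<exists>a b. (u, a) \<in> parcs G \<and> a \<noteq> v \<and> (v, b) \<in> parcs G \<and> b \<noteq> u \<and>
      (a = b \<or> (a, b) \<in> parcs G \<or> (b, a) \<in> parcs G))" (is "?l \<longleftrightarrow> ?r")
proof
  assume ?l
  then obtain w where uv: "u \<noteq> v" and w: "w \<noteq> u" "w \<noteq> v"
    and "ddist (pre_digraph.del_vert (with_proj G) v) u w \<le> 1 \<and>
         ddist (pre_digraph.del_vert (with_proj G) u) v w \<le> 2 \<or>
         ddist (pre_digraph.del_vert (with_proj G) u) v w \<le> 1 \<and>
         ddist (pre_digraph.del_vert (with_proj G) v) u w \<le> 2"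
    unfolding comp12_graph_def by auto
  then show ?r
    using ddist_del_vert_le_1[of u w v] ddist_del_vert_le_1[of v w u]
      ddist_del_vert_le_2[of u w v] ddist_del_vert_le_2[of v w u] by metis
next
  assume ?r
  then obtain a b where uv: "u \<noteq> v" and ab: "(u, a) \<in> parcs G" "a \<noteq> v" "(v, b) \<in> parcs G" "b \<noteq> u"
    and or: "a = b \<or> (a, b) \<in> parcs G \<or> (b, a) \<in> parcs G" by blast
  have V: "u \<in> pverts G" "v \<in> pverts G" "a \<in> pverts G" "b \<in> pverts G"
    using ab in_arcsD1 in_arcsD2 by auto
  have ne: "u \<noteq> a" "v \<noteq> b" using no_loops'[OF ab(1)] no_loops'[OF ab(3)] by auto
  \<comment> \<open>The witness is the head of the arc between \<open>a\<close> and
    \<open>b\<close>, or \<open>a\<close> itself if they coincide.\<close>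
  have a: "ddist (pre_digraph.del_vert (with_proj G) v) u a \<le> 1 \<and>
         ddist (pre_digraph.del_vert (with_proj G) u) v a \<le> 2" if "a = b \<or> (b, a) \<in> parcs G"
    using ddist_del_vert_le_1[of u a v] ddist_del_vert_le_2[of v a u] that ab ne uv by metis
  have b: "ddist (pre_digraph.del_vert (with_proj G) u) v b \<le> 1 \<and>
         ddist (pre_digraph.del_vert (with_proj G) v) u b \<le> 2" if "(a, b) \<in> parcs G"
    using ddist_del_vert_le_1[of v b u] ddist_del_vert_le_2[of u b v] that ab ne uv by metis
  have "\<exists>w \<in> pverts G - {u, v}.
          ddist (pre_digraph.del_vert (with_proj G) v) u w \<le> 1 \<and>
          ddist (pre_digraph.del_vert (with_proj G) u) v w \<le> 2 \<or>
          ddist (pre_digraph.del_vert (with_proj G) u) v w \<le> 1 \<and>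
          ddist (pre_digraph.del_vert (with_proj G) v) u w \<le> 2"
  proof (cases "(a, b) \<in> parcs G")
    case True
    then show ?thesis using b ab ne V by (intro bexI[of _ b]) auto
  next
    case False
    then show ?thesis using a or ab ne V by (intro bexI[of _ a]) auto
  qed
  then show ?l using V uv unfolding comp12_graph_def by simp
qed

end

section \<open>From closed walks to integer-indexed cycles\<close>

lemma cycle_fst_snd:
  assumes "pre_digraph.cycle (with_proj L) p"
  shows "distinct (map fst p)" "k < length p \<Longrightarrow> snd (p ! k) = fst (p ! (Suc k mod length p))"
proof -
  obtain u where cas: "pre_digraph.cas (with_proj L) u p u"
    and d: "distinct (tl (pre_digraph.awalk_verts (with_proj L) u p))" and ne: "p \<noteq> []"
    using assms unfolding pre_digraph.cycle_def pre_digraph.awalk_def by blast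
  \<comment> \<open>Stated for open walks to allow induction: the vertex list is the tails followed
    by the endpoint, and the heads are this list shifted by one.\<close>
  have aw: "pre_digraph.cas (with_proj L) x q y \<Longrightarrow>
    pre_digraph.awalk_verts (with_proj L) x q = map fst q @ [y] \<and>
    map snd q = tl (map fst q @ [y]) \<and> x = hd (map fst q @ [y])"
    for x q y
    proof (induction q arbitrary: x)
    case Nil
    then show ?case by (simp add: pre_digraph.cas.simps pre_digraph.awalk_verts.simps)
  next
    case (Cons e q)
    then have "x = fst e" "pre_digraph.cas (with_proj L) (snd e) q y" by (auto simp: pre_digraph.cas.simps)
    with Cons.IH[OF this(2)] show ?case by (cases q) (auto simp: pre_digraph.awalk_verts.simps)
  qed
  from aw[OF cas] ne have 1: "map snd p = tl (map fst p) @ [u]" "u = fst (hd p)"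
    "distinct (tl (map fst p) @ [u])"
    using d by (auto simp: hd_append hd_map)
  show "distinct (map fst p)" using 1 ne by (cases p) auto
  show "snd (p ! k) = fst (p ! (Suc k mod length p))" if k: "k < length p"
  proof -
    have "snd (p ! k) = (tl (map fst p) @ [u]) ! k" using 1(1) k by (metis nth_map)
    also have "\<dots> = fst (p ! (Suc k mod length p))"
    proof (cases "Suc k < length p")
      case True
      then show ?thesis by (auto simp: nth_append nth_tl less_diff_conv)
    next
      case False
      then have "Suc k = length p" using k by simp
      then show ?thesis using ne 1(2) by (auto simp: nth_append hd_conv_nth)
    qed
    finally show ?thesis .
  qed
qed

lemma hole_cyclic:
  assumes "hole G L"
  obtains c where "pverts L = range c" "range c \<subseteq> pverts G"
    "\<And>i j. c i = c j \<longleftrightarrow> int (card (pverts L)) dvd i - j"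
    "\<And>i j. (c i, c j) \<in> parcs G \<longleftrightarrow>
       int (card (pverts L)) dvd i - j - 1 \<or> int (card (pverts L)) dvd i - j + 1"
proof -
  obtain p where p: "pre_digraph.cycle (with_proj L) p" "3 \<le> length p"
    and V: "pverts L = fst ` set p" and arcs: "parcs L = set p \<union> (set p)\<inverse>"
    using assms unfolding hole_def cycle_graph_def by blast
  have ind: "pverts L \<subseteq> pverts G" "parcs L = {e \<in> parcs G. fst e \<in> pverts L \<and> snd e \<in> pverts L}"
    using assms unfolding hole_def induced_subgraph_def subgraph_def by auto
  define m where "m = length p"
  have m: "0 < m" using p(2) unfolding m_def by linarith
  define n where "n = int m"
  have n: "0 < n" using m n_def by simp
  have dist: "distinct (map fst p)" using cycle_fst_snd[OF p(1)] by blast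
  have card: "card (pverts L) = m" unfolding V m_def using distinct_card[OF dist] by simp
  define c where "c i = fst (p ! nat (i mod n))" for i
  have idx: "nat (i mod n) < m" for i using n unfolding n_def by (simp add: nat_less_iff)
  have c_eq: "c i = c j \<longleftrightarrow> n dvd i - j" for i j
  proof -
    have "c i = c j \<longleftrightarrow> nat (i mod n) = nat (j mod n)"
      using nth_eq_iff_index_eq[OF dist, of "nat (i mod n)" "nat (j mod n)"] idx
      unfolding c_def by (simp add: m_def)
    also have "\<dots> \<longleftrightarrow> i mod n = j mod n" using n by (simp add: nat_eq_iff)
    also have "\<dots> \<longleftrightarrow> n dvd i - j" by (rule mod_eq_dvd_iff)
    finally show ?thesis .
  qed
  have c_nat: "c (int k) = fst (p ! k)" if "k < m" for k
    using that unfolding c_def n_def by simp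
  have nth: "p ! k = (c (int k), c (int k + 1))" if k: "k < m" for k
  proof -
    have "(int k + 1) mod n = int (Suc k mod m)" unfolding n_def by (simp add: zmod_int add.commute)
    then have "c (int k + 1) = fst (p ! (Suc k mod m))" unfolding c_def by simp
    also have "\<dots> = snd (p ! k)" using cycle_fst_snd(2)[OF p(1), of k] k unfolding m_def by simp
    finally show ?thesis using c_nat[OF k] by (simp add: prod_eq_iff)
  qed
  have range: "range c = pverts L"
  proof
    show "range c \<subseteq> pverts L" unfolding V c_def using idx unfolding m_def by auto
    show "pverts L \<subseteq> range c"
      unfolding V using c_nat by (auto simp: in_set_conv_nth m_def) (metis fst_conv rangeI)
  qed
  \<comment> \<open>Arcs of \<open>p\<close> lead from an index to its successor, hence the
    \<open>+ 1\<close>; the reversed arcs will give the \<open>- 1\<close>.\<close>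
  have mem: "(c i, c j) \<in> set p \<longleftrightarrow> n dvd i - j + 1" for i j
  proof
    assume "(c i, c j) \<in> set p"
    then obtain k where "k < m" "p ! k = (c i, c j)" by (auto simp: in_set_conv_nth m_def)
    then have "c i = c (int k)" "c j = c (int k + 1)" using nth by auto
    then have "n dvd (i - int k) - (j - (int k + 1))" unfolding c_eq by (rule dvd_diff)
    then show "n dvd i - j + 1" by (simp add: algebra_simps)
  next
    assume d: "n dvd i - j + 1"
    define k where "k = nat (i mod n)"
    have k: "k < m" "int k = i mod n" using idx n unfolding k_def by auto
    have i: "n dvd i - int k" unfolding k(2) by (simp add: minus_mod_eq_mult_div)
    have "n dvd (i - int k) - (i - j + 1)" using i d by (rule dvd_diff)
    then have "c i = c (int k)" "c j = c (int k + 1)" using i unfolding c_eq by (simp_all add: algebra_simps)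
    then have "(c i, c j) = p ! k" using nth[OF k(1)] by simp
    then show "(c i, c j) \<in> set p" using k(1) unfolding m_def by simp
  qed
  have "(c i, c j) \<in> parcs G \<longleftrightarrow> n dvd i - j - 1 \<or> n dvd i - j + 1" for i j
  proof -
    have "(c i, c j) \<in> parcs G \<longleftrightarrow> (c i, c j) \<in> parcs L" using ind(2) range by auto
    also have "\<dots> \<longleftrightarrow> n dvd i - j + 1 \<or> n dvd j - i + 1" unfolding arcs using mem by auto
    also have "n dvd j - i + 1 \<longleftrightarrow> n dvd i - j - 1" using dvd_minus_iff[of n "i - j - 1"] by (simp add: algebra_simps)
    finally show ?thesis by blast
  qed
  then show ?thesis using that[of c] range ind(1) c_eq card unfolding n_def by auto
qed

section \<open>The theorem for multipartite tournaments\<close>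

definition part_of :: "'a set set \<Rightarrow> 'a \<Rightarrow> 'a set" where
  "part_of P v = (THE X. X \<in> P \<and> v \<in> X)"

lemma part_of_eq: "\<lbrakk>partition_on V P; X \<in> P; v \<in> X\<rbrakk> \<Longrightarrow> part_of P v = X"
  unfolding part_of_def by (rule the_equality) (auto simp: partition_on_def disjoint_def)

theorem theorem4p5:
  fixes D :: "'a pair_pre_digraph" and P :: "'a set set"
  assumes "multipartite_tournament D P"
    and "loose D P"
    and "\<exists>L. hole (comp12_graph D) L \<and> 5 \<le> card (pverts L)"
  shows "\<exists>X \<in> P.
    (\<not> competing12 D X \<and> (\<forall>Z \<in> P. \<not> competing12 D Z \<longrightarrow> Z = X)) \<and>
    (\<forall>L. hole (comp12_graph D) L \<and> 5 \<le> card (pverts L) \<longrightarrow>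
      (\<exists>Y \<in> P. Y \<noteq> X \<and> card (pverts L) \<le> card Y \<and>
        pverts L \<subseteq> {v \<in> pverts D. out_nbrs D v \<noteq> {} \<and> out_nbrs D v \<subseteq> Y} \<and>
        {v \<in> pverts D. out_nbrs D v \<noteq> {} \<and> out_nbrs D v \<subseteq> Y} \<subseteq> X))"
proof -
  interpret D: pair_digraph D using multipartite_tournament_pair_digraph[OF assms(1)] .
  have part: "partition_on (pverts D) P" and V: "pverts D = \<Union>P" and fin: "finite (pverts D)"
    and or: "parcs D \<union> (parcs D)\<inverse> = {(u, v). \<exists>X \<in> P. \<exists>Y \<in> P. X \<noteq> Y \<and> u \<in> X \<and> v \<in> Y}"
    and asym: "parcs D \<inter> (parcs D)\<inverse> = {}"
    using assms(1) unfolding multipartite_tournament_def orientation_def complete_multipartite_def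
      pair_pre_digraph.simps
    by - (elim conjE, assumption)+
  let ?f = "part_of P"
  have f: "?f v = X" if "X \<in> P" "v \<in> X" for v X using part_of_eq[OF part that] .
  have fP: "?f v \<in> P" "v \<in> ?f v" if "v \<in> pverts D" for v using that f V by auto
  have mem: "v \<in> X \<longleftrightarrow> ?f v = X" if "v \<in> pverts D" "X \<in> P" for v X using that f fP by auto
  interpret M: oriented_multipartite "pverts D" "\<lambda>x y. (x, y) \<in> parcs D" ?f
  proof
    fix x y
    show "x \<in> pverts D \<and> y \<in> pverts D" if "(x, y) \<in> parcs D"
      using that D.in_arcsD1 D.in_arcsD2 by auto
    show "(y, x) \<notin> parcs D" if "(x, y) \<in> parcs D" using that asym by auto
    show "?f x \<noteq> ?f y" if "(x, y) \<in> parcs D"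
    proof -
      have "(x, y) \<in> parcs D \<union> (parcs D)\<inverse>" using that by simp
      then show ?thesis unfolding or using f by auto
    qed
    show "(x, y) \<in> parcs D \<or> (y, x) \<in> parcs D" if "x \<in> pverts D" "y \<in> pverts D" "?f x \<noteq> ?f y"
    proof -
      have "(x, y) \<in> parcs D \<union> (parcs D)\<inverse>" unfolding or using that fP by blast
      then show ?thesis by simp
    qed
  qed
  have adj: "(u, v) \<in> parcs (comp12_graph D) \<longleftrightarrow> M.compete u v" for u v
    unfolding D.comp12_arc_iff M.compete_def using M.arc_total M.arc_parts M.arc_verts by metis
  have comp: "competing12 D Z \<longleftrightarrow> (\<forall>u \<in> Z. \<forall>v \<in> Z. u \<noteq> v \<longrightarrow> M.compete u v)" if "Z \<in> P" for Z
    using that V unfolding competing12_def clique_def adj by (auto simp: comp12_graph_def)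
  \<comment> \<open>Here \<open>X\<close> may depend on the hole; being the only part that is not
    competing, it turns out to be the same for all holes.\<close>
  have main: "\<exists>X \<in> P. (\<not> competing12 D X \<and> (\<forall>Z \<in> P. \<not> competing12 D Z \<longrightarrow> Z = X)) \<and>
      (\<exists>Y \<in> P. Y \<noteq> X \<and> card (pverts L) \<le> card Y \<and>
        pverts L \<subseteq> {v \<in> pverts D. out_nbrs D v \<noteq> {} \<and> out_nbrs D v \<subseteq> Y} \<and>
        {v \<in> pverts D. out_nbrs D v \<noteq> {} \<and> out_nbrs D v \<subseteq> Y} \<subseteq> X)"
    if L: "hole (comp12_graph D) L" "5 \<le> card (pverts L)" for L
  proof -
    obtain c where c: "pverts L = range c" "range c \<subseteq> pverts (comp12_graph D)"
      "\<And>i j. c i = c j \<longleftrightarrow> int (card (pverts L)) dvd i - j"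
      "\<And>i j. (c i, c j) \<in> parcs (comp12_graph D) \<longleftrightarrow>
         int (card (pverts L)) dvd i - j - 1 \<or> int (card (pverts L)) dvd i - j + 1"
      using hole_cyclic[OF L(1)] by metis
    have cyc: "M.hole_cycle (int (card (pverts L))) c"
    proof -
      have "pverts (comp12_graph D) = pverts D" by (simp add: comp12_graph_def)
      then show ?thesis unfolding M.hole_cycle_def using L(2) c(2-4) by (auto simp flip: adj)
    qed
    have cV: "c i \<in> pverts D" for i using M.cV[OF cyc] .
    define X where "X = ?f (c 0)"
    have XP: "X \<in> P" and cX: "c i \<in> X" for i
      using fP[OF cV] M.same_part[OF cyc, of i 0] unfolding X_def by metis+
    obtain Y where out: "\<And>i x. (c i, x) \<in> parcs D \<Longrightarrow> ?f x = Y" using M.out_part[OF cyc] by metis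
    obtain a where a: "(c 0, a) \<in> parcs D" using M.c_out[OF cyc] by blast
    then have aV: "a \<in> pverts D" using M.arc_verts by blast
    have YP: "Y \<in> P" using out[OF a] fP[OF aV] by simp
    have YX: "Y \<noteq> X" using M.arc_parts[OF a] out[OF a] unfolding X_def by simp
    have sub: "out_nbrs D v \<subseteq> Y \<longleftrightarrow> (\<forall>x. (v, x) \<in> parcs D \<longrightarrow> ?f x = Y)" for v
      unfolding out_nbrs_def using mem[OF _ YP] M.arc_verts by auto
    have "\<not> M.compete (c 0) (c 2)" "c 0 \<noteq> c 2" using M.c_nonadj[OF cyc] M.c_ne[OF cyc] by simp_all
    then have "\<not> competing12 D X" using comp[OF XP] cX by metis
    moreover have "Z = X" if Z: "Z \<in> P" "\<not> competing12 D Z" for Z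
    proof (rule ccontr)
      assume ne: "Z \<noteq> X"
      obtain z1 z2 where z: "z1 \<in> Z" "z2 \<in> Z" "z1 \<noteq> z2" "\<not> M.compete z1 z2" using Z comp by blast
      then show False using M.other_part_adj[OF cyc, of z1 z2] f Z(1) V ne unfolding X_def by auto
    qed
    moreover have "card (pverts L) \<le> card Y"
    proof -
      have "finite Y" using YP V fin by (auto intro: finite_subset)
      moreover have "x \<in> Y" if "(c i, x) \<in> parcs D" for i x
        using out[OF that] mem[OF _ YP] M.arc_verts[OF that] by blast
      ultimately show ?thesis using M.out_card[OF cyc, of Y] by simp
    qed
    moreover have "pverts L \<subseteq> {v \<in> pverts D. out_nbrs D v \<noteq> {} \<and> out_nbrs D v \<subseteq> Y}"
      unfolding c(1) sub using cV M.c_out[OF cyc] out by (auto simp: out_nbrs_def)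
    moreover have "{v \<in> pverts D. out_nbrs D v \<noteq> {} \<and> out_nbrs D v \<subseteq> Y} \<subseteq> X"
    proof
      fix v assume v: "v \<in> {v \<in> pverts D. out_nbrs D v \<noteq> {} \<and> out_nbrs D v \<subseteq> Y}"
      then obtain b where "(v, b) \<in> parcs D" unfolding out_nbrs_def by blast
      moreover have "\<And>x. (v, x) \<in> parcs D \<Longrightarrow> ?f x = Y" using v sub by blast
      ultimately have "?f v = X" using M.out_in_part[OF cyc, of Y v b 0] out unfolding X_def by metis
      then show "v \<in> X" using mem XP v by blast
    qed
    ultimately show ?thesis using XP YP YX by blast
  qed
  obtain L0 where L0: "hole (comp12_graph D) L0" "5 \<le> card (pverts L0)" using assms(3) by blast
  obtain X where X: "X \<in> P" "\<not> competing12 D X" "\<And>Z. Z \<in> P \<Longrightarrow> \<not> competing12 D Z \<Longrightarrow> Z = X"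
    using main[OF L0] by (elim bexE conjE) blast
  show ?thesis
  proof (rule bexI[OF _ X(1)], intro conjI allI impI ballI)
    fix L assume "hole (comp12_graph D) L \<and> 5 \<le> card (pverts L)"
    then have L: "hole (comp12_graph D) L" "5 \<le> card (pverts L)" by auto
    obtain X' Y where X': "X' \<in> P" "\<not> competing12 D X'" and Y: "Y \<in> P" "Y \<noteq> X'" "card (pverts L) \<le> card Y"
      "pverts L \<subseteq> {v \<in> pverts D. out_nbrs D v \<noteq> {} \<and> out_nbrs D v \<subseteq> Y}"
      "{v \<in> pverts D. out_nbrs D v \<noteq> {} \<and> out_nbrs D v \<subseteq> Y} \<subseteq> X'"
      using main[OF L] by (elim bexE conjE) (rule that)
    have "X' = X" using X(3)[OF X'] .
    with Y show "\<exists>Y \<in> P. Y \<noteq> X \<and> card (pverts L) \<le> card Y \<and>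
        pverts L \<subseteq> {v \<in> pverts D. out_nbrs D v \<noteq> {} \<and> out_nbrs D v \<subseteq> Y} \<and>
        {v \<in> pverts D. out_nbrs D v \<noteq> {} \<and> out_nbrs D v \<subseteq> Y} \<subseteq> X" by blast
  qed (use X in blast)+
qed

end
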